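(* Let $k \geq 2$, let $\Sigma_k=\{s_1,\dots,s_k\}$, let $F_k=F(\Sigma_k)$ be the free group on $\Sigma_k$, and write $S_i=s_i^{-1}$ for $i=1,\dots,k$. Define a map $w:F_k\to\mathbb{R}$ as follows. For an element of $F_k$ represented by the reduced word $u$ over $\Sigma_k^{\pm}=\{s_1,\dots,s_k,S_1,\dots,S_k\}$, set $$w(u)=\#\{\text{subwords of } u \text{ of the form } s_jS_i \text{ with } j>i\}-\#\{\text{subwords of } u \text{ of the form } S_js_i \text{ with } j>i\}+\tfrac12\,\epsilon(u),$$ where $\epsilon(u)=1$ if the last (rightmost) letter of $u$ is a positive letter $s_i$ for some $i$, $\epsilon(u)=-1$ if the last letter of $u$ is a negative letter $S_i$ for some $i$, and $\epsilon(u)=0$ if $u$ is the trivial (empty) word. Let $$P_k=\{u\in F_k \mid w(u)>0\}.$$ Then $P_k$ is the positive cone of a left order on $F_k$; that is, the relation defined by $$u>v \iff w(v^{-1}u)>0 \qquad (u,v\in F_k)$$ is the strict part of a left order on $F_k$. Moreover, this left order extends the lexicographic order on the free monoid $\Sigma_k^*$ based on the order $s_1<s_2<\dots<s_k$ of the letters.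
   Context: A left order on a group $G$ is a linear (total) order $\leq$ on $G$ such that for all $f,g,h\in G$, $f\leq g$ implies $hf\leq hg$. Its positive cone is the set of elements $g$ with $g>e$, where $e$ is the identity. Elements of $F_k$ are identified with reduced words over $\Sigma_k^{\pm}$ (words with no two adjacent letters inverse to each other). A subword of length 2 is a pair of consecutive letters, and the numbers of subwords count occurrences (positions) in the word. The free monoid $\Sigma_k^*$ is the submonoid of $F_k$ consisting of the words in the positive letters $s_1,\dots,s_k$ (including the empty word $e$). The lexicographic order on $\Sigma_k^*$ based on $s_1<\dots<s_k$ is the dictionary order: $u<v$ if and only if either $u$ is a proper prefix of $v$, or at the first position (from the left) at which $u$ and $v$ differ, the letter of $u$ is smaller than the letter of $v$. "Extends" means that the restriction of the left order to $\Sigma_k^*$ is the lexicographic order. *)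

theory Defs
  imports Complex_Main "HOL-Algebra.Group"
begin

datatype 'a letter = Pos 'a | Neg 'a

fun inv_letter :: "'a letter \<Rightarrow> 'a letter" where
  "inv_letter (Pos a) = Neg a"
| "inv_letter (Neg a) = Pos a"

lemma inv_letter_inv_letter [simp]: "inv_letter (inv_letter x) = x"
  by (cases x) auto

definition reduced :: "'a letter list \<Rightarrow> bool" where
  "reduced w \<longleftrightarrow> successively (\<lambda>x y. y \<noteq> inv_letter x) w"

definition words :: "'a set \<Rightarrow> 'a letter list set" where
  "words X = lists (Pos ` X \<union> Neg ` X)"

fun cancel_cons :: "'a letter \<Rightarrow> 'a letter list \<Rightarrow> 'a letter list" where
  "cancel_cons x [] = [x]"
| "cancel_cons x (y # w) = (if y = inv_letter x then w else x # y # w)"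

definition reduce :: "'a letter list \<Rightarrow> 'a letter list" where
  "reduce w = foldr cancel_cons w []"

definition free_group :: "'a set \<Rightarrow> 'a letter list monoid" where
  "free_group X =
     \<lparr>carrier = {w \<in> words X. reduced w}, mult = (\<lambda>u v. reduce (u @ v)), one = []\<rparr>"

lemma reduced_cancel_cons: "reduced w \<Longrightarrow> reduced (cancel_cons x w)"
  by (cases w) (auto simp: reduced_def successively_Cons)

lemma reduced_foldr: "reduced v \<Longrightarrow> reduced (foldr cancel_cons u v)"
  by (induction u) (auto simp: reduced_cancel_cons)

lemma reduced_reduce: "reduced (reduce w)"
  unfolding reduce_def by (rule reduced_foldr) (simp add: reduced_def)

lemma reduce_reduced: "reduced w \<Longrightarrow> reduce w = w"
proof (induction w)
  case (Cons x w)
  then show ?case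
    by (cases w) (auto simp: reduced_def reduce_def)
qed (simp add: reduce_def)

lemma words_cancel_cons:
  "x \<in> Pos ` X \<union> Neg ` X \<Longrightarrow> w \<in> words X \<Longrightarrow> cancel_cons x w \<in> words X"
  by (cases w) (auto simp: words_def)

lemma words_reduce: "w \<in> words X \<Longrightarrow> reduce w \<in> words X"
proof (induction w)
  case (Cons x w)
  then have "x \<in> Pos ` X \<union> Neg ` X" "reduce w \<in> words X"
    by (auto simp: words_def)
  then show ?case
    using words_cancel_cons by (simp add: reduce_def)
qed (simp add: reduce_def)

lemma cancel_cons_inv_letter:
  assumes "reduced w"
  shows "cancel_cons (inv_letter x) (cancel_cons x w) = w"
proof (cases w)
  case (Cons y v)
  then show ?thesis
    using assms by (cases v) (auto simp: reduced_def)
qed simp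

lemma foldr_cancel_cons:
  assumes "reduced z"
  shows "foldr cancel_cons (cancel_cons x u) z = cancel_cons x (foldr cancel_cons u z)"
proof (cases u)
  case (Cons y v)
  then show ?thesis
    using cancel_cons_inv_letter[OF reduced_foldr[OF assms], of "inv_letter x" v] by auto
qed simp

lemma foldr_reduce:
  "reduced z \<Longrightarrow> foldr cancel_cons (reduce w) z = foldr cancel_cons w z"
  by (induction w) (auto simp: reduce_def foldr_cancel_cons)

lemma reduce_append: "reduce (u @ v) = foldr cancel_cons u (reduce v)"
  by (simp add: reduce_def)

lemma reduce_append_reduce:
  "reduce (reduce u @ v) = reduce (u @ v)" "reduce (u @ reduce v) = reduce (u @ v)"
  by (simp_all add: reduce_append foldr_reduce reduced_reduce reduce_reduced)

lemma foldr_inverse: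
  "reduced z \<Longrightarrow> foldr cancel_cons (rev (map inv_letter u)) (foldr cancel_cons u z) = z"
  by (induction u) (auto simp: cancel_cons_inv_letter reduced_foldr)

lemma group_free_group: "group (free_group X)"
proof (rule groupI)
  fix u assume u: "u \<in> carrier (free_group X)"
  let ?v = "reduce (rev (map inv_letter u))"
  have "rev (map inv_letter u) \<in> words X"
    using u by (fastforce simp: free_group_def words_def)
  then have "?v \<in> carrier (free_group X)"
    by (simp add: free_group_def words_reduce reduced_reduce)
  moreover have "?v \<otimes>\<^bsub>free_group X\<^esub> u = \<one>\<^bsub>free_group X\<^esub>"
    using foldr_inverse[of "[]" u]
    by (simp add: free_group_def reduce_append_reduce) (simp add: reduce_def reduced_def)
  ultimately show "\<exists>v \<in> carrier (free_group X). v \<otimes>\<^bsub>free_group X\<^esub> u = \<one>\<^bsub>free_group X\<^esub>"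
    by blast
qed (auto simp: free_group_def reduce_append_reduce reduced_reduce reduce_reduced
      intro!: words_reduce, auto simp: words_def reduced_def)

definition left_order :: "('a, 'b) monoid_scheme \<Rightarrow> 'a rel \<Rightarrow> bool" where
  "left_order G r \<longleftrightarrow> linear_order_on (carrier G) r \<and>
     (\<forall>f \<in> carrier G. \<forall>g \<in> carrier G. \<forall>h \<in> carrier G.
        (f, g) \<in> r \<longrightarrow> (h \<otimes>\<^bsub>G\<^esub> f, h \<otimes>\<^bsub>G\<^esub> g) \<in> r)"

definition positive_cone :: "('a, 'b) monoid_scheme \<Rightarrow> 'a rel \<Rightarrow> 'a set" where
  "positive_cone G r = {g \<in> carrier G. (\<one>\<^bsub>G\<^esub>, g) \<in> r - Id}"

definition epsilon :: "'a letter list \<Rightarrow> real" where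
  "epsilon u =
     (if u = [] then 0 else case last u of Pos i \<Rightarrow> 1 | Neg i \<Rightarrow> -1)"

definition weight :: "nat letter list \<Rightarrow> real" where
  "weight u =
     real (card {p. Suc p < length u \<and> (\<exists>i j. i < j \<and> u ! p = Pos j \<and> u ! Suc p = Neg i)})
   - real (card {p. Suc p < length u \<and> (\<exists>i j. i < j \<and> u ! p = Neg j \<and> u ! Suc p = Pos i)})
   + 1 / 2 * epsilon u"

text \<open>The letters \<open>Pos i\<close> and \<open>Neg i\<close> with \<open>1 \<le> i \<le> k\<close> stand for \<open>s\<^sub>i\<close> and \<open>S\<^sub>i\<close>.\<close>

definition Fk :: "nat \<Rightarrow> nat letter list monoid" where
  "Fk k = free_group {1..k}"

definition Pk :: "nat \<Rightarrow> nat letter list set" where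
  "Pk k = {u \<in> carrier (Fk k). weight u > 0}"

definition free_monoid :: "nat \<Rightarrow> nat letter list set" where
  "free_monoid k = lists (Pos ` {1..k})"

definition lex_order :: "nat \<Rightarrow> nat letter list rel" where
  "lex_order k = {(u, v). u \<in> free_monoid k \<and> v \<in> free_monoid k \<and>
     (u = v \<or> (u, v) \<in> lexord {(Pos i, Pos j) | i j. i < j})}"

end

theory Submission
  imports Defs
begin

text \<open>
  Read a reduced word as a path in the Cayley tree of the free group: the weight adds up
  contributions of the turns that the path makes at its inner vertices, corrected by half the sign
  of the last letter.  The correction has two effects.  First, the weight of a nontrivial
  element is half an odd integer, hence nonzero and, if positive, at least \<open>1/2\<close>
  (\<open>weight_cases\<close>).  Second, the weight changes sign under inversion (\<open>weight_winv\<close>): a word and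
  its inverse together count every change of sign of the letters once, those from positive to
  negative as \<open>1\<close> and the others as \<open>-1\<close>; these changes alternate, so their total
  depends only on the signs of the first and the last letter.  Thus exactly one of \<open>g\<close> and
  \<open>g\<inverse>\<close> has positive weight if \<open>g\<close> is nontrivial.

  It remains to see that the elements of positive weight are closed under products.  When
  \<open>a\<close> and \<open>b\<close> are nontrivial and \<open>a b\<close> is reduced, its weight exceeds the sum of
  the weights of \<open>a\<close> and \<open>b\<close> by a number that depends only on two directions at the vertex \<open>a\<close>: the one leading back to the
  identity and the one leading on to \<open>a b\<close>.  It is \<open>1/2\<close> if the first comes before the second
  in the linear order \<open>s\<^sub>1 < \<dots> < s\<^sub>k < S\<^sub>k < \<dots> < S\<^sub>1\<close>, and \<open>-1/2\<close> otherwise (\<open>weight_append\<close>).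
  For arbitrary \<open>u\<close> and \<open>v\<close> the points \<open>1\<close>, \<open>u\<close> and \<open>u v\<close> span a tripod, that is,
  \<open>u = a b\<inverse>\<close> and \<open>v = b c\<close> with \<open>a c\<close> reduced.  The contributions of the three legs
  cancel because of the antisymmetry, and only the three directions \<open>x\<close>, \<open>y\<close>, \<open>z\<close> at the
  centre of the tripod matter.  If \<open>w(u) + w(v)\<close> exceeded \<open>w(u v)\<close> by more than \<open>1/2\<close>, then \<open>x\<close>
  would come before \<open>y\<close> and \<open>y\<close> before \<open>z\<close>, but not \<open>x\<close> before \<open>z\<close>, against transitivity
  (\<open>weight_product\<close>).  So if \<open>u\<close> and \<open>v\<close> have weight at least \<open>1/2\<close>, then so has \<open>u v\<close>.

  For positive words \<open>u\<close> and \<open>v\<close> the decomposition of \<open>u\<inverse> v\<close> displays the lexicographic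
  comparison: their longest common prefix cancels, and a nontrivial remainder contributes \<open>-1/2\<close>
  on the side of \<open>u\<close> and \<open>1/2\<close> on the side of \<open>v\<close>.  If both remainders are nontrivial, these
  numbers cancel, and what decides is the order of the letters at which the words part
  (\<open>lexord_Pos_iff_weight\<close>).
\<close>

section \<open>Left orders from positive cones\<close>

definition cone_order :: "('a, 'b) monoid_scheme \<Rightarrow> 'a set \<Rightarrow> 'a rel" where
  "cone_order G P = {(v, u). v \<in> carrier G \<and> u \<in> carrier G \<and> (v = u \<or> inv\<^bsub>G\<^esub> v \<otimes>\<^bsub>G\<^esub> u \<in> P)}"

context group
begin

lemma inv_mult_mult_cancel:
  assumes "f \<in> carrier G" "g \<in> carrier G" "h \<in> carrier G"
  shows "inv (h \<otimes> f) \<otimes> (h \<otimes> g) = inv f \<otimes> g"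
proof -
  have "inv h \<otimes> (h \<otimes> g) = g"
    using assms by (simp add: m_assoc[symmetric])
  then show ?thesis
    using assms by (simp add: inv_mult_group m_assoc)
qed

lemma left_order_cone_order:
  assumes closed: "\<And>g h. g \<in> P \<Longrightarrow> h \<in> P \<Longrightarrow> g \<otimes> h \<in> P"
    and one: "\<one> \<notin> P"
    and total: "\<And>g. g \<in> carrier G \<Longrightarrow> g \<noteq> \<one> \<Longrightarrow> g \<in> P \<or> inv g \<in> P"
  shows "left_order G (cone_order G P)"
proof -
  let ?r = "cone_order G P"
  have comp: "(inv u \<otimes> v) \<otimes> (inv v \<otimes> w) = inv u \<otimes> w"
    if "u \<in> carrier G" "v \<in> carrier G" "w \<in> carrier G" for u v w
    using that by (simp add: m_assoc[symmetric]) (simp add: m_assoc)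
  have "refl_on (carrier G) ?r" "?r \<subseteq> carrier G \<times> carrier G"
    by (auto simp: refl_on_def cone_order_def)
  moreover have "trans ?r"
  proof (rule transI)
    fix u v w assume uv: "(u, v) \<in> ?r" and vw: "(v, w) \<in> ?r"
    show "(u, w) \<in> ?r"
    proof (cases "u = v \<or> v = w")
      case False
      then show ?thesis
        using uv vw closed[of "inv u \<otimes> v" "inv v \<otimes> w"] comp[of u v w]
        by (auto simp: cone_order_def)
    qed (use uv vw in auto)
  qed
  moreover have "antisym ?r"
  proof (rule antisymI, rule ccontr)
    fix u v assume uv: "(u, v) \<in> ?r" and vu: "(v, u) \<in> ?r" and ne: "u \<noteq> v"
    then show False
      using closed[of "inv u \<otimes> v" "inv v \<otimes> u"] comp[of u v u] one
      by (auto simp: cone_order_def)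
  qed
  moreover have "total_on (carrier G) ?r"
  proof (rule total_onI)
    fix u v assume uv: "u \<in> carrier G" "v \<in> carrier G" "u \<noteq> v"
    have "inv u \<otimes> v \<noteq> \<one>"
      using uv by (metis inv_equality inv_inv inv_closed)
    moreover have "inv (inv u \<otimes> v) = inv v \<otimes> u"
      using uv by (simp add: inv_mult_group)
    ultimately have "inv u \<otimes> v \<in> P \<or> inv v \<otimes> u \<in> P"
      using total[of "inv u \<otimes> v"] uv by auto
    then show "(u, v) \<in> ?r \<or> (v, u) \<in> ?r"
      using uv by (auto simp: cone_order_def)
  qed
  moreover have "(h \<otimes> f, h \<otimes> g) \<in> ?r"
    if "f \<in> carrier G" "g \<in> carrier G" "h \<in> carrier G" "(f, g) \<in> ?r" for f g h
    using that by (auto simp: cone_order_def inv_mult_mult_cancel)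
  ultimately show ?thesis
    by (simp add: left_order_def linear_order_on_def partial_order_on_def preorder_on_def)
qed

lemma cone_order_strict:
  assumes "\<one> \<notin> P"
  shows "cone_order G P - Id = {(v, u). v \<in> carrier G \<and> u \<in> carrier G \<and> inv v \<otimes> u \<in> P}"
  using assms by (auto simp: cone_order_def)

lemma positive_cone_cone_order:
  assumes "P \<subseteq> carrier G" "\<one> \<notin> P"
  shows "positive_cone G (cone_order G P) = P"
  using assms by (auto simp: positive_cone_def cone_order_def)

end

section \<open>Inverting and multiplying reduced words\<close>

definition winv :: "'a letter list \<Rightarrow> 'a letter list" where
  "winv u = rev (map inv_letter u)"

lemma winv_simps [simp]:
  "winv [] = []" "winv (u @ v) = winv v @ winv u" "winv (x # u) = winv u @ [inv_letter x]"
  "winv (winv u) = u" "winv u = [] \<longleftrightarrow> u = []"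
  by (simp_all add: winv_def rev_map comp_def)

lemma hd_winv: "u \<noteq> [] \<Longrightarrow> hd (winv u) = inv_letter (last u)"
  and last_winv: "u \<noteq> [] \<Longrightarrow> last (winv u) = inv_letter (hd u)"
  by (simp_all add: winv_def hd_rev last_rev last_map hd_map)

lemma inv_letter_eq_iff [simp]: "inv_letter x = inv_letter y \<longleftrightarrow> x = y"
  by (metis inv_letter_inv_letter)

lemma reduced_simps [simp]: "reduced []" "reduced [x]"
  by (simp_all add: reduced_def)

lemma reduced_append_iff:
  "reduced (u @ v) \<longleftrightarrow>
     reduced u \<and> reduced v \<and> (u \<noteq> [] \<longrightarrow> v \<noteq> [] \<longrightarrow> hd v \<noteq> inv_letter (last u))"
  unfolding reduced_def by (auto simp: successively_append_iff)

lemma reduced_winv: "reduced u \<Longrightarrow> reduced (winv u)"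
proof (induction u)
  case (Cons x u)
  then show ?case
    using reduced_append_iff[of "[x]" u]
    by (cases "u = []") (auto simp: reduced_append_iff last_winv)
qed simp

lemma inv_free_group:
  assumes "u \<in> carrier (free_group X)"
  shows "inv\<^bsub>free_group X\<^esub> u = winv u"
proof -
  interpret group "free_group X" by (rule group_free_group)
  have "winv u \<in> words X"
    using assms by (fastforce simp: free_group_def words_def winv_def)
  then have "winv u \<in> carrier (free_group X)"
    using assms by (simp add: free_group_def reduced_winv)
  moreover have "winv u \<otimes>\<^bsub>free_group X\<^esub> u = \<one>\<^bsub>free_group X\<^esub>"
    using foldr_inverse[of "[]" u] by (simp add: free_group_def reduce_def reduced_def winv_def)
  ultimately show ?thesis
    using assms by (simp add: inv_equality)
qed

lemma reduce_append_cancel: "reduce (a @ winv b @ b @ c) = reduce (a @ c)"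
  by (simp add: reduce_append foldr_inverse reduced_reduce winv_def)

text \<open>
  The tripod spanned by \<open>1\<close>, \<open>u\<close> and \<open>u v\<close>: its centre is \<open>a\<close>, and \<open>b\<close> is the part of \<open>v\<close> that
  cancels.  Each step of the induction on \<open>u\<close> from the right cancels one letter.
\<close>

lemma product_decomposition:
  assumes "reduced u" "reduced v"
  obtains a b c where "u = a @ winv b" "v = b @ c" "reduced (a @ c)" "reduce (u @ v) = a @ c"
proof -
  have "\<exists>a b c. u = a @ winv b \<and> v = b @ c \<and> reduced (a @ c)"
    using assms
  proof (induction u arbitrary: v rule: rev_induct)
    case Nil
    then show ?case by (intro exI[of _ "[]"] exI[of _ v]) auto
  next
    case (snoc x u)
    show ?case
    proof (cases "v \<noteq> [] \<and> hd v = inv_letter x")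
      case True
      then obtain v' where v: "v = inv_letter x # v'" by (cases v) auto
      have "reduced u" "reduced v'"
        using snoc.prems v reduced_append_iff[of "[inv_letter x]" v'] by (auto simp: reduced_append_iff)
      from snoc.IH[OF this] obtain a b c where "u = a @ winv b" "v' = b @ c" "reduced (a @ c)"
        by blast
      then show ?thesis
        using v by (intro exI[of _ a] exI[of _ "inv_letter x # b"] exI[of _ c]) auto
    next
      case False
      then have "reduced ((u @ [x]) @ v)"
        using snoc.prems unfolding reduced_append_iff[of "u @ [x]"] by auto
      then show ?thesis
        by (intro exI[of _ "u @ [x]"] exI[of _ "[]"] exI[of _ v]) auto
    qed
  qed
  then show thesis
    using that by (metis append_assoc reduce_append_cancel reduce_reduced)
qed

section \<open>The weight as a sum over the turns of a path\<close>

fun sign :: "'a letter \<Rightarrow> real" where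
  "sign (Pos i) = 1"
| "sign (Neg i) = - 1"

fun turn :: "'a::linorder letter \<Rightarrow> 'a letter \<Rightarrow> real" where
  "turn (Pos j) (Neg i) = of_bool (i < j)"
| "turn (Neg j) (Pos i) = - of_bool (i < j)"
| "turn _ _ = 0"

fun turns :: "'a::linorder letter list \<Rightarrow> real" where
  "turns (x # y # u) = turn x y + turns (y # u)"
| "turns _ = 0"

lemma epsilon_eq: "u \<noteq> [] \<Longrightarrow> epsilon u = sign (last u)"
  by (cases "last u") (auto simp: epsilon_def)

lemma card_adjacent:
  "real (card {p. Suc p < length u \<and> Q (u ! p) (u ! Suc p)}) =
     (\<Sum>p<length u - 1. of_bool (Q (u ! p) (u ! Suc p)))"
proof -
  have "{p. Suc p < length u \<and> Q (u ! p) (u ! Suc p)}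
      = {..<length u - 1} \<inter> {p. Q (u ! p) (u ! Suc p)}"
    by auto
  then show ?thesis by (simp add: of_bool_def sum.If_cases)
qed

lemma sum_turns: "(\<Sum>p<length u - 1. turn (u ! p) (u ! Suc p)) = turns u"
  by (induction u rule: turns.induct) (simp_all add: sum.lessThan_Suc_shift del: sum.lessThan_Suc)

lemma weight_eq: "weight u = turns u + 1/2 * epsilon u"
proof -
  have turn: "of_bool (\<exists>i j. i < j \<and> x = Pos j \<and> y = Neg i)
      - of_bool (\<exists>i j. i < j \<and> x = Neg j \<and> y = Pos i) = turn x y" for x y :: "nat letter"
    by (cases x; cases y) auto
  show ?thesis
    unfolding weight_def
      card_adjacent[of u "\<lambda>x y. \<exists>i j. i < j \<and> x = Pos j \<and> y = Neg i"]
      card_adjacent[of u "\<lambda>x y. \<exists>i j. i < j \<and> x = Neg j \<and> y = Pos i"]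
      sum_subtractf[symmetric] turn sum_turns ..
qed

lemma weight_Nil [simp]: "weight [] = 0"
  by (simp add: weight_eq epsilon_def)

lemma turns_append:
  "a \<noteq> [] \<Longrightarrow> b \<noteq> [] \<Longrightarrow> turns (a @ b) = turns a + turn (last a) (hd b) + turns b"
proof (induction a rule: turns.induct)
  case ("2_2" x)
  then show ?case by (cases b) auto
qed auto

lemma turns_Ints: "turns u \<in> \<int>"
proof (induction u rule: turns.induct)
  case (1 x y u)
  have "turn x y \<in> \<int>" by (cases x; cases y) auto
  then show ?case using 1 by simp
qed auto

text \<open>The weight differs from an integer by the half sign of the last letter.\<close>

lemma weight_cases:
  assumes "u \<noteq> []"
  shows "weight u \<ge> 1/2 \<or> weight u \<le> - 1/2"
proof -
  obtain n where n: "turns u = of_int n"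
    using turns_Ints[of u] by (auto elim: Ints_cases)
  consider "n \<le> - 1" | "n = 0" | "n \<ge> 1"
    by linarith
  then have "turns u \<le> - 1 \<or> turns u = 0 \<or> turns u \<ge> 1"
    unfolding n by cases linarith+
  then show ?thesis
    using assms by (cases "last u") (auto simp: weight_eq epsilon_eq)
qed

text \<open>
  The indices of \<open>x\<close> and \<open>y\<close> differ when their signs do, so exactly one of the turn and its
  reversal is counted, whichever of the two indices is larger.
\<close>

lemma turn_inverse:
  "y \<noteq> inv_letter x \<Longrightarrow> turn x y + turn (inv_letter y) (inv_letter x) = (sign x - sign y) / 2"
  by (cases x; cases y) auto

lemma sign_inv_letter [simp]: "sign (inv_letter x) = - sign x"
  by (cases x) auto

text \<open>The right-hand side of \<open>turn_inverse\<close> telescopes along the word.\<close>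

lemma turns_winv:
  "reduced u \<Longrightarrow> u \<noteq> [] \<Longrightarrow> turns u + turns (winv u) = (sign (hd u) - sign (last u)) / 2"
proof (induction u rule: turns.induct)
  case (1 x y u)
  then have "y \<noteq> inv_letter x" "reduced (y # u)"
    by (simp_all add: reduced_def)
  moreover have "turns (winv (x # y # u)) = turns (winv (y # u)) + turn (inv_letter y) (inv_letter x)"
    using turns_append[of "winv (y # u)" "[inv_letter x]"] by simp
  ultimately show ?case
    using 1 turn_inverse[of y x] by (simp add: field_simps)
qed auto

lemma weight_winv:
  assumes "reduced u"
  shows "weight (winv u) = - weight u"
proof (cases "u = []")
  case False
  then show ?thesis
    using turns_winv[OF assms] by (simp add: weight_eq epsilon_eq last_winv field_simps)
qed simp

section \<open>The local order at a vertex\<close>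

text \<open>
  Letters stand here for the directions in which edges leave a vertex, taken in the order
  \<open>s\<^sub>1 < \<dots> < s\<^sub>k < S\<^sub>k < \<dots> < S\<^sub>1\<close>.
\<close>

fun before :: "'a::linorder letter \<Rightarrow> 'a letter \<Rightarrow> bool" where
  "before (Pos i) (Pos j) \<longleftrightarrow> i < j"
| "before (Pos i) (Neg j) \<longleftrightarrow> True"
| "before (Neg i) (Pos j) \<longleftrightarrow> False"
| "before (Neg i) (Neg j) \<longleftrightarrow> j < i"

lemma before_trans: "before x y \<Longrightarrow> before y z \<Longrightarrow> before x z"
  by (cases x; cases y; cases z) auto

definition local_sign :: "'a::linorder letter \<Rightarrow> 'a letter \<Rightarrow> real" where
  "local_sign x y = (if before x y then 1/2 else - 1/2)"

text \<open>
  This is where the particular choice of the counted subwords enters: with the correction by the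
  sign of \<open>x\<close>, a turn compares the direction it comes from with the direction it goes to.
\<close>

lemma turn_eq_local_sign:
  "y \<noteq> inv_letter x \<Longrightarrow> turn x y - sign x / 2 = local_sign (inv_letter x) y"
  by (cases x; cases y) (auto simp: local_sign_def)

text \<open>
  The sign of the last letter of \<open>a\<close> counts in the weight of \<open>a\<close> but not in that of \<open>a b\<close>; this
  supplies the correction needed in \<open>turn_eq_local_sign\<close>.
\<close>

lemma weight_append:
  assumes "reduced (a @ b)" "a \<noteq> []" "b \<noteq> []"
  shows "weight (a @ b) = weight a + weight b + local_sign (inv_letter (last a)) (hd b)"
  using assms turn_eq_local_sign[of "hd b" "last a"]
  by (simp add: weight_eq epsilon_eq turns_append reduced_append_iff field_simps)

text \<open>
  If all legs of the tripod are nontrivial, the excess is the sum of three local signs at its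
  centre, which transitivity keeps from being \<open>3/2\<close>.  If a leg is trivial, the excess is at most
  a single local sign in absolute value.
\<close>

lemma weight_product:
  assumes "reduced u" "reduced v"
  shows "weight u + weight v - weight (reduce (u @ v)) \<le> 1/2"
proof -
  obtain a b c where u: "u = a @ winv b" and v: "v = b @ c" and ac: "reduced (a @ c)"
    and uv: "reduce (u @ v) = a @ c"
    using product_decomposition[OF assms] .
  have bound: "\<bar>local_sign x y\<bar> \<le> 1/2" for x y :: "nat letter"
    by (simp add: local_sign_def)
  have b: "weight (winv b) = - weight b"
    using assms(2) v by (simp add: reduced_append_iff weight_winv)
  consider "a = []" | "a \<noteq> []" "b = []" | "a \<noteq> []" "b \<noteq> []" "c = []" | "a \<noteq> []" "b \<noteq> []" "c \<noteq> []"
    by blast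
  then show ?thesis
  proof cases
    case 1
    then show ?thesis
      using weight_append[of b c] assms(2) uv u v b bound[of "inv_letter (last b)" "hd c"]
      by (cases "b = [] \<or> c = []") auto
  next
    case 2
    then show ?thesis
      using weight_append[of a c] ac uv u v bound[of "inv_letter (last a)" "hd c"]
      by (cases "c = []") auto
  next
    case 3
    then show ?thesis
      using weight_append[of a "winv b"] assms(1) uv u v b bound[of "inv_letter (last a)" "hd (winv b)"]
      by auto
  next
    case 4
    let ?x = "inv_letter (last a)" and ?y = "inv_letter (last b)" and ?z = "hd c"
    have "weight u + weight v - weight (reduce (u @ v))
        = local_sign ?x ?y + local_sign ?y ?z - local_sign ?x ?z"
      using 4 weight_append[of a "winv b"] weight_append[of b c] weight_append[of a c]
        assms ac b by (simp add: uv) (simp add: u v hd_winv)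
    also have "\<dots> \<le> 1/2"
      using before_trans[of ?x ?y ?z] by (auto simp: local_sign_def)
    finally show ?thesis .
  qed
qed

section \<open>Positive words\<close>

lemma weight_positive_word:
  assumes "set u \<subseteq> range Pos" "u \<noteq> []"
  shows "weight u = 1/2"
proof -
  have "turns u = 0"
    using assms(1) by (induction u rule: turns.induct) auto
  moreover have "last u \<in> range Pos"
    using assms last_in_set by blast
  ultimately show ?thesis
    using assms by (auto simp: weight_eq epsilon_eq)
qed

text \<open>
  After cancelling the longest common prefix, the element to be weighed is \<open>b\<inverse> c\<close>, where \<open>b\<close> and
  \<open>c\<close> are positive words without common first letter.  If exactly one of them is empty, one of the
  given words is a proper prefix of the other, and the sign comes from the last letter; if
  neither is empty, the weights \<open>-1/2\<close> of \<open>b\<inverse>\<close> and \<open>1/2\<close> of \<open>c\<close> cancel and leave the local comparison of first letters.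
\<close>

lemma lexord_Pos_iff_weight:
  fixes u v :: "nat letter list"
  assumes u: "set u \<subseteq> range Pos" "reduced u" and v: "set v \<subseteq> range Pos" "reduced v"
  shows "weight (reduce (winv u @ v)) > 0 \<longleftrightarrow> (u, v) \<in> lexord {(Pos i, Pos j) | i j. i < j}"
    (is "_ \<longleftrightarrow> _ \<in> lexord ?R")
proof -
  obtain a p c where a: "winv u = a @ winv p" and v_eq: "v = p @ c" and ac: "reduced (a @ c)"
    and uv: "reduce (winv u @ v) = a @ c"
    using product_decomposition[OF reduced_winv[OF u(2)] v(2)] .
  define b where "b = winv a"
  have a_eq: "a = winv b"
    by (simp add: b_def)
  have "u = winv (a @ winv p)"
    unfolding a[symmetric] by simp
  then have u_eq: "u = p @ b"
    by (simp add: b_def)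
  have lex: "(u, v) \<in> lexord ?R \<longleftrightarrow> (b, c) \<in> lexord ?R"
    by (auto simp: u_eq v_eq lexord_same_pref_iff irrefl_def)
  have wb: "weight (winv b) = - 1/2" if "b \<noteq> []"
    using that u u_eq weight_winv[of b] weight_positive_word[of b] by (simp add: reduced_append_iff)
  have wc: "weight c = 1/2" if "c \<noteq> []"
    using that v v_eq weight_positive_word[of c] by simp
  consider "c = []" | "b = []" "c \<noteq> []" | "b \<noteq> []" "c \<noteq> []"
    by blast
  then show ?thesis
  proof cases
    case 1
    then show ?thesis
      unfolding uv lex using wb by (cases "b = []") (auto simp: a_eq)
  next
    case 2
    then show ?thesis
      unfolding uv lex using wc by (cases c) (auto simp: a_eq)
  next
    case 3
    then obtain i b' j c' where bc: "b = Pos i # b'" "c = Pos j # c'"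
      using u v unfolding u_eq v_eq by (cases b; cases c) auto
    have "i \<noteq> j"
      using reduced_append_iff[of a c] ac by (auto simp: a_eq bc)
    moreover have "weight (a @ c) = local_sign (Pos i) (Pos j)"
      using weight_append[of a c] ac 3 wb wc by (simp add: a_eq last_winv) (simp add: bc)
    ultimately show ?thesis
      unfolding uv lex by (auto simp: bc local_sign_def)
  qed
qed

lemma reduced_positive_word: "set u \<subseteq> range Pos \<Longrightarrow> reduced u"
proof (induction u)
  case (Cons x u)
  then show ?case
    by (cases u) (auto simp: reduced_def)
qed simp

theorem theorem1:
  fixes k :: nat
  assumes "k \<ge> 2"
  shows "\<exists>r. left_order (Fk k) r
    \<and> positive_cone (Fk k) r = Pk k
    \<and> r - Id = {(v, u). v \<in> carrier (Fk k) \<and> u \<in> carrier (Fk k)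
                   \<and> weight (inv\<^bsub>Fk k\<^esub> v \<otimes>\<^bsub>Fk k\<^esub> u) > 0}
    \<and> Restr r (free_monoid k) = lex_order k"
proof (intro exI conjI)
  interpret group "Fk k"
    unfolding Fk_def by (rule group_free_group)
  have red: "reduced u" if "u \<in> carrier (Fk k)" for u
    using that by (simp add: Fk_def free_group_def)
  have mult: "u \<otimes>\<^bsub>Fk k\<^esub> v = reduce (u @ v)" for u v
    by (simp add: Fk_def free_group_def)
  have inv: "inv\<^bsub>Fk k\<^esub> u = winv u" if "u \<in> carrier (Fk k)" for u
    using that unfolding Fk_def by (rule inv_free_group)
  have one: "\<one>\<^bsub>Fk k\<^esub> = []"
    by (simp add: Fk_def free_group_def)
  have one_notin: "\<one>\<^bsub>Fk k\<^esub> \<notin> Pk k"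
    by (simp add: Pk_def one)
  show "left_order (Fk k) (cone_order (Fk k) (Pk k))"
  proof (rule left_order_cone_order)
    fix u v assume uv: "u \<in> Pk k" "v \<in> Pk k"
    then have "weight u \<ge> 1/2" "weight v \<ge> 1/2"
      using weight_cases[of u] weight_cases[of v] by (cases "u = []"; cases "v = []"; force simp: Pk_def)+
    then have "weight (u \<otimes>\<^bsub>Fk k\<^esub> v) > 0"
      using uv weight_product[of u v] by (simp add: Pk_def red mult)
    then show "u \<otimes>\<^bsub>Fk k\<^esub> v \<in> Pk k"
      using uv by (simp add: Pk_def)
  next
    fix u assume u: "u \<in> carrier (Fk k)" "u \<noteq> \<one>\<^bsub>Fk k\<^esub>"
    then have "weight u > 0 \<or> weight (winv u) > 0"
      using weight_cases[of u] weight_winv[of u] by (auto simp: one red)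
    then show "u \<in> Pk k \<or> inv\<^bsub>Fk k\<^esub> u \<in> Pk k"
      using u inv_closed[of u] by (auto simp: Pk_def inv)
  qed (rule one_notin)
  show "positive_cone (Fk k) (cone_order (Fk k) (Pk k)) = Pk k"
    using one_notin by (intro positive_cone_cone_order) (auto simp: Pk_def)
  show "cone_order (Fk k) (Pk k) - Id = {(v, u). v \<in> carrier (Fk k) \<and> u \<in> carrier (Fk k)
      \<and> weight (inv\<^bsub>Fk k\<^esub> v \<otimes>\<^bsub>Fk k\<^esub> u) > 0}"
    unfolding cone_order_strict[OF one_notin] by (auto simp: Pk_def)
  have pos: "set u \<subseteq> range Pos" "u \<in> carrier (Fk k)" if "u \<in> free_monoid k" for u
  proof -
    show "set u \<subseteq> range Pos"
      using that by (auto simp: free_monoid_def)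
    then show "u \<in> carrier (Fk k)"
      using that reduced_positive_word[of u]
      by (auto simp: free_monoid_def Fk_def free_group_def words_def)
  qed
  have "(u, v) \<in> cone_order (Fk k) (Pk k) \<longleftrightarrow> (u, v) \<in> lex_order k"
    if "u \<in> free_monoid k" "v \<in> free_monoid k" for u v
  proof -
    have "inv\<^bsub>Fk k\<^esub> u \<otimes>\<^bsub>Fk k\<^esub> v \<in> Pk k \<longleftrightarrow> weight (reduce (winv u @ v)) > 0"
      using that pos(2) m_closed[of "inv\<^bsub>Fk k\<^esub> u" v] inv_closed[of u]
      by (simp add: Pk_def inv mult)
    also have "\<dots> \<longleftrightarrow> (u, v) \<in> lexord {(Pos i, Pos j) | i j. i < j}"
      using that by (intro lexord_Pos_iff_weight pos(1) red pos(2))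
    finally show ?thesis
      using that by (auto simp: cone_order_def lex_order_def pos(2))
  qed
  then show "Restr (cone_order (Fk k) (Pk k)) (free_monoid k) = lex_order k"
    by (auto simp: lex_order_def)
qed

end
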